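(* Let $\mathbf{F}$ be a field and let $\{A,B,C\}$ be a dual $3$-net of order $4$ embedded in $PG(2,\mathbf{F})$. Then $A\cup B\cup C$ is contained in a cubic curve, i.e. there is a nonzero homogeneous polynomial of degree $3$ over $\mathbf{F}$ vanishing at all points of $A\cup B\cup C$.
   Context: A dual $3$-net of order $n$ embedded in $PG(2,\mathbf{F})$ is a triple $\{A,B,C\}$ of pairwise disjoint point-sets of $PG(2,\mathbf{F})$, each of size $n$ (called components), such that every line meeting two distinct components meets each of the three components in precisely one point. *)

theory Defs
  imports "HOL-Analysis.Cartesian_Space" "HOL-Library.Poly_Mapping"
begin

text \<open>The plane $PG(2,F)$: points and lines are the one- and two-dimensional linear subspaces
  of $F^3$, and incidence is inclusion.\<close>

definition pg2_points :: "('a::field ^ 3) set set" where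
  "pg2_points = {P. vec.subspace P \<and> vec.dim P = 1}"

definition pg2_lines :: "('a::field ^ 3) set set" where
  "pg2_lines = {L. vec.subspace L \<and> vec.dim L = 2}"

definition meets :: "('a::field ^ 3) set \<Rightarrow> ('a ^ 3) set set \<Rightarrow> bool" where
  "meets L X \<longleftrightarrow> (\<exists>P\<in>X. P \<subseteq> L)"

definition dual_3_net ::
  "nat \<Rightarrow> ('a::field ^ 3) set set \<Rightarrow> ('a ^ 3) set set \<Rightarrow> ('a ^ 3) set set \<Rightarrow> bool" where
  "dual_3_net n A B C \<longleftrightarrow>
     A \<subseteq> pg2_points \<and> B \<subseteq> pg2_points \<and> C \<subseteq> pg2_points \<and>
     A \<inter> B = {} \<and> A \<inter> C = {} \<and> B \<inter> C = {} \<and>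
     finite A \<and> card A = n \<and> finite B \<and> card B = n \<and> finite C \<and> card C = n \<and>
     (\<forall>L\<in>pg2_lines. \<forall>X\<in>{A, B, C}. \<forall>Y\<in>{A, B, C}.
        X \<noteq> Y \<and> meets L X \<and> meets L Y \<longrightarrow>
        (\<forall>Z\<in>{A, B, C}. \<exists>!P. P \<in> Z \<and> P \<subseteq> L))"

text \<open>Polynomials in three variables are formal objects, not functions: over a small finite field
  a nonzero polynomial may vanish everywhere. A monomial is an exponent vector
  \<^typ>\<open>3 \<Rightarrow>\<^sub>0 nat\<close>, and a polynomial maps finitely many monomials to nonzero coefficients.\<close>

type_synonym 'a poly3 = "(3 \<Rightarrow>\<^sub>0 nat) \<Rightarrow>\<^sub>0 'a"

definition eval_poly3 :: "'a::field poly3 \<Rightarrow> 'a ^ 3 \<Rightarrow> 'a" where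
  "eval_poly3 p v =
     (\<Sum>m\<in>Poly_Mapping.keys p.
        Poly_Mapping.lookup p m * (\<Prod>i\<in>UNIV. (v $ i) ^ Poly_Mapping.lookup m i))"

definition homogeneous3 :: "nat \<Rightarrow> 'a::field poly3 \<Rightarrow> bool" where
  "homogeneous3 d p \<longleftrightarrow>
     (\<forall>m\<in>Poly_Mapping.keys p. (\<Sum>i\<in>UNIV. Poly_Mapping.lookup m i) = d)"

definition vanishes_at :: "'a::field poly3 \<Rightarrow> ('a ^ 3) set \<Rightarrow> bool" where
  "vanishes_at p P \<longleftrightarrow> (\<forall>v\<in>P. eval_poly3 p v = 0)"

end

theory Submission
  imports Defs
begin

text \<open>Label the net by \<open>a\<^sub>i, b\<^sub>j, c\<^sub>k\<close> with index set \<open>{0, 1, 2, 3}\<close>, so that the lines are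
  \<open>a\<^sub>i b\<^sub>j c\<^bsub>L i j\<^esub>\<close> for a Latin square \<open>L\<close> with first row and first column in natural order; there are
  only four such squares. A cubic form has ten coefficients, so some nonzero cubic vanishes at the nine
  points \<open>a\<^sub>0, \<dots>, a\<^sub>3, b\<^sub>0, b\<^sub>1, b\<^sub>2, c\<^sub>0, c\<^sub>1\<close>. Nine points of the net may be the intersections of two
  triples of lines of the net, and then, by the Cayley--Bacharach theorem, a cubic through eight of them passes
  through the ninth. For each of the four squares, three such grids in succession carry the cubic to
  \<open>c\<^sub>2\<close>, \<open>c\<^sub>3\<close> and \<open>b\<^sub>3\<close>.\<close>

subsection \<open>Forms in three variables\<close>

text \<open>Forms are polynomial functions, not formal polynomials: over a small field a form may be zero as a
  function without having zero coefficients. Only the existence of a nonzero cubic needs formal coefficients.\<close>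

primrec hform :: "nat \<Rightarrow> ('a::field ^ 3 \<Rightarrow> 'a) set" where
  "hform 0 = range (\<lambda>c _. c)"
| "hform (Suc d) = {f. \<exists>g. (\<forall>i. g i \<in> hform d) \<and> f = (\<lambda>v. \<Sum>i\<in>UNIV. v $ i * g i v)}"

lemma hform_SucI: "(\<And>i. g i \<in> hform d) \<Longrightarrow> (\<lambda>v. \<Sum>i\<in>UNIV. v $ i * g i v) \<in> hform (Suc d)"
  by auto

lemma hform_zero: "(\<lambda>_. 0) \<in> hform d"
proof (induction d)
  case (Suc d)
  then show ?case using hform_SucI[of "\<lambda>_ _. 0" d] by simp
qed auto

lemma hform_add: "f \<in> hform d \<Longrightarrow> g \<in> hform d \<Longrightarrow> (\<lambda>v. f v + g v) \<in> hform d"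
proof (induction d arbitrary: f g)
  case (Suc d)
  then obtain f' g' where "\<And>i. f' i \<in> hform d" "f = (\<lambda>v. \<Sum>i\<in>UNIV. v $ i * f' i v)"
    "\<And>i. g' i \<in> hform d" "g = (\<lambda>v. \<Sum>i\<in>UNIV. v $ i * g' i v)" by auto
  then show ?case
    using hform_SucI[of "\<lambda>i v. f' i v + g' i v" d] Suc.IH
    by (simp add: distrib_left sum.distrib)
qed auto

lemma hform_mult: "f \<in> hform d \<Longrightarrow> g \<in> hform e \<Longrightarrow> (\<lambda>v. f v * g v) \<in> hform (d + e)"
proof (induction d arbitrary: f)
  case 0
  then obtain c where f: "f = (\<lambda>_. c)" by auto
  from 0(2) show ?case unfolding f
  proof (induction e arbitrary: g)
    case (Suc e)
    then obtain g' where g': "\<And>i. g' i \<in> hform e" "g = (\<lambda>v. \<Sum>i\<in>UNIV. v $ i * g' i v)" by auto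
    show ?case
      using hform_SucI[of "\<lambda>i v. c * g' i v" e] Suc.IH[OF g'(1)] g'(2)
      by (simp add: sum_distrib_left mult.left_commute)
  qed auto
next
  case (Suc d)
  then obtain f' where f': "\<And>i. f' i \<in> hform d" "f = (\<lambda>v. \<Sum>i\<in>UNIV. v $ i * f' i v)" by auto
  show ?case
    using hform_SucI[of "\<lambda>i v. f' i v * g v" "d + e"] Suc.IH[OF f'(1) Suc.prems(2)] f'(2)
    by (simp add: sum_distrib_right mult.assoc)
qed

lemma hform_scale: "f \<in> hform d \<Longrightarrow> (\<lambda>v. c * f v) \<in> hform d"
  using hform_mult[of "\<lambda>_. c" 0 f d] by auto

lemma hform_scale': "f \<in> hform d \<Longrightarrow> (\<lambda>v. f v * c) \<in> hform d"
  using hform_scale[of f d c] by (simp add: mult.commute)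

lemma hform_diff: "f \<in> hform d \<Longrightarrow> g \<in> hform d \<Longrightarrow> (\<lambda>v. f v - g v) \<in> hform d"
  using hform_add[of f d "\<lambda>v. (-1) * g v"] hform_scale[of g d "-1"] by simp

lemma hform_sum: "(\<And>i. i \<in> I \<Longrightarrow> f i \<in> hform d) \<Longrightarrow> (\<lambda>v. \<Sum>i\<in>I. f i v) \<in> hform d"
  by (induction I rule: infinite_finite_induct) (auto intro: hform_zero hform_add)

text \<open>Peel off one variable of positive exponent. This is what turns the evaluation of a
  formal polynomial into a form.\<close>

lemma hform_monomial:
  "(\<Sum>i\<in>UNIV. m i) = d \<Longrightarrow> (\<lambda>v :: 'a::field ^ 3. \<Prod>i\<in>UNIV. (v $ i) ^ m i) \<in> hform d"
proof (induction d arbitrary: m)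
  case (Suc d)
  then obtain k where k: "m k > 0" by (metis (no_types, lifting) gr0I nat.distinct(1) sum.neutral)
  define m' where "m' = m(k := m k - 1)"
  have "(\<Sum>i\<in>UNIV. m i) = m k + (\<Sum>i\<in>UNIV - {k}. m' i)"
    by (subst sum.remove[of _ k]) (auto simp: m'_def)
  moreover have "(\<Sum>i\<in>UNIV. m' i) = m k - 1 + (\<Sum>i\<in>UNIV - {k}. m' i)"
    by (subst sum.remove[of _ k]) (auto simp: m'_def)
  ultimately have "(\<Sum>i\<in>UNIV. m' i) = d" using k Suc.prems by simp
  then have IH: "(\<lambda>v :: 'a ^ 3. \<Prod>i\<in>UNIV. (v $ i) ^ m' i) \<in> hform d" by (rule Suc.IH)
  have eq: "(\<Prod>i\<in>UNIV. (v $ i) ^ m i) = v $ k * (\<Prod>i\<in>UNIV. (v $ i) ^ m' i)" for v :: "'a ^ 3"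
  proof -
    have "(\<Prod>i\<in>UNIV - {k}. (v $ i) ^ m i) = (\<Prod>i\<in>UNIV - {k}. (v $ i) ^ m' i)"
      by (auto simp: m'_def intro: prod.cong)
    moreover have "(v $ k) ^ m k = v $ k * (v $ k) ^ m' k"
      using k by (simp add: m'_def power_eq_if)
    ultimately show ?thesis
      by (simp add: prod.remove[of UNIV k] mult.assoc)
  qed
  \<comment> \<open>The recursive definition asks for one coefficient per coordinate; all except the
    one at \<open>k\<close> are zero.\<close>
  have "(\<lambda>v :: 'a ^ 3. \<Sum>i\<in>UNIV. v $ i * (if i = k then \<Prod>i\<in>UNIV. (v $ i) ^ m' i else 0))
      \<in> hform (Suc d)"
  proof (rule hform_SucI)
    show "(\<lambda>v :: 'a ^ 3. if i = k then \<Prod>i\<in>UNIV. (v $ i) ^ m' i else 0) \<in> hform d" for i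
      by (cases "i = k") (use IH hform_zero in simp_all)
  qed
  moreover have "(\<lambda>v :: 'a ^ 3. \<Sum>i\<in>UNIV. v $ i * (if i = k then \<Prod>i\<in>UNIV. (v $ i) ^ m' i else 0))
      = (\<lambda>v. \<Prod>i\<in>UNIV. (v $ i) ^ m i)"
    by (simp add: eq if_distrib[of "\<lambda>t. _ * t"] sum.delta cong: if_cong)
  ultimately show ?case by simp
qed auto

lemma hform_1E:
  assumes "f \<in> hform 1" obtains u where "f = (\<lambda>v. \<Sum>i\<in>UNIV. v $ i * u i)"
proof -
  from assms obtain g where g: "\<forall>i. \<exists>c. g i = (\<lambda>_. c)" "f = (\<lambda>v. \<Sum>i\<in>UNIV. v $ i * g i v)"
    by (auto simp: image_iff)
  from g(1) obtain u where "\<And>i. g i = (\<lambda>_. u i)" by metis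
  with g(2) that show ?thesis by simp
qed

lemma hform_1_linear:
  assumes "f \<in> hform 1"
  shows "f (v + w) = f v + f w" "f (c *s v) = c * f v"
proof -
  from assms obtain u where "f = (\<lambda>v. \<Sum>i\<in>UNIV. v $ i * u i)" by (rule hform_1E)
  then show "f (v + w) = f v + f w" "f (c *s v) = c * f v"
    by (simp_all add: distrib_right sum.distrib sum_distrib_left mult.assoc)
qed

text \<open>Substitute the decomposition of \<open>v\<close> for the factors \<open>v $ i\<close> in
  the definition of \<open>hform\<close>. In the applications \<open>z\<close> is, up to scale, the
  equation of the line through \<open>p\<close> and \<open>q\<close>.\<close>

lemma hform_expand:
  assumes "f \<in> hform (Suc d)" and v: "\<And>v. v = x v *s p + y v *s q + z v *s w"
  obtains g h k where "g \<in> hform d" "h \<in> hform d" "k \<in> hform d"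
    "\<And>v. f v = x v * g v + y v * h v + z v * k v"
proof -
  from assms(1) obtain e where e: "\<And>i. e i \<in> hform d" "f = (\<lambda>v. \<Sum>i\<in>UNIV. v $ i * e i v)" by auto
  have "(\<lambda>v. \<Sum>i\<in>UNIV. u $ i * e i v) \<in> hform d" for u :: "'a ^ 3"
    by (intro hform_sum hform_scale e)
  moreover have "f v = x v * (\<Sum>i\<in>UNIV. p $ i * e i v) + y v * (\<Sum>i\<in>UNIV. q $ i * e i v)
      + z v * (\<Sum>i\<in>UNIV. w $ i * e i v)" for v
  proof -
    have "v $ i = x v * p $ i + y v * q $ i + z v * w $ i" for i
      by (subst v) simp
    then have "f v = (\<Sum>i\<in>UNIV. (x v * p $ i + y v * q $ i + z v * w $ i) * e i v)"
      using e(2) by simp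
    then show ?thesis by (simp add: distrib_right sum.distrib sum_distrib_left mult.assoc)
  qed
  ultimately show ?thesis by (intro that) auto
qed

lemma hform_0E: assumes "f \<in> hform 0" obtains c where "\<And>v. f v = c"
  using assms by auto

text \<open>Expanding twice and gathering the multiples of \<open>z\<close> leaves a binary
  quadratic form in \<open>x\<close> and \<open>y\<close>, the restriction of \<open>f\<close> to
  the line \<open>z = 0\<close>. Linearity of \<open>x\<close> and \<open>y\<close> keeps the
  cofactor of \<open>z\<close> linear.\<close>

lemma quadratic_expand:
  assumes "f \<in> hform 2" and v: "\<And>v. v = x v *s p + y v *s q + z v *s w"
    and xy: "x \<in> hform 1" "y \<in> hform 1"
  obtains a b c g where "g \<in> hform 1"
    "\<And>v. f v = a * x v ^ 2 + b * x v * y v + c * y v ^ 2 + z v * g v"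
proof -
  obtain g h k where g: "g \<in> hform (Suc 0)" "h \<in> hform (Suc 0)" "k \<in> hform (Suc 0)"
    "\<And>v. f v = x v * g v + y v * h v + z v * k v"
    by (rule hform_expand[OF _ v, of f "Suc 0"]) (use assms in \<open>auto simp only: numeral_2_eq_2\<close>)
  obtain g1 g2 g3 where "g1 \<in> hform 0" "g2 \<in> hform 0" "g3 \<in> hform 0"
      "\<And>v. g v = x v * g1 v + y v * g2 v + z v * g3 v"
    using hform_expand[OF g(1) v] by blast
  then obtain a1 a2 a3 where a: "\<And>v. g v = x v * a1 + y v * a2 + z v * a3"
    by (metis hform_0E)
  obtain h1 h2 h3 where "h1 \<in> hform 0" "h2 \<in> hform 0" "h3 \<in> hform 0"
      "\<And>v. h v = x v * h1 v + y v * h2 v + z v * h3 v"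
    using hform_expand[OF g(2) v] by blast
  then obtain b1 b2 b3 where b: "\<And>v. h v = x v * b1 + y v * b2 + z v * b3"
    by (metis hform_0E)
  show ?thesis
  proof (rule that)
    show "(\<lambda>v. a3 * x v + b3 * y v + k v) \<in> hform 1"
      using xy g(3) by (auto intro!: hform_add hform_scale simp del: hform.simps)
    show "f v = a1 * x v ^ 2 + (a2 + b1) * x v * y v + b2 * y v ^ 2
        + z v * (a3 * x v + b3 * y v + k v)" for v
      unfolding g(4) a b by (simp add: algebra_simps power2_eq_square)
  qed
qed

text \<open>Expand once, then apply the quadratic case to the coefficients of \<open>x\<close> and
  \<open>y\<close>.\<close>

lemma cubic_expand:
  assumes "f \<in> hform 3" and v: "\<And>v. v = x v *s p + y v *s q + z v *s w"
    and xy: "x \<in> hform 1" "y \<in> hform 1"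
  obtains a b c d g where "g \<in> hform 2"
    "\<And>v. f v = a * x v ^ 3 + b * x v ^ 2 * y v + c * x v * y v ^ 2 + d * y v ^ 3 + z v * g v"
proof -
  obtain g h k where g: "g \<in> hform 2" "h \<in> hform 2" "k \<in> hform 2"
    "\<And>v. f v = x v * g v + y v * h v + z v * k v"
    by (rule hform_expand[OF _ v, of f 2]) (use assms in \<open>auto simp only: eval_nat_numeral\<close>)
  obtain a1 a2 a3 m where a: "m \<in> hform 1"
      "\<And>v. g v = a1 * x v ^ 2 + a2 * x v * y v + a3 * y v ^ 2 + z v * m v"
    using quadratic_expand[OF g(1) v xy] by metis
  obtain b1 b2 b3 n where b: "n \<in> hform 1"
      "\<And>v. h v = b1 * x v ^ 2 + b2 * x v * y v + b3 * y v ^ 2 + z v * n v"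
    using quadratic_expand[OF g(2) v xy] by metis
  show ?thesis
  proof (rule that)
    have "(\<lambda>v. x v * m v) \<in> hform (1 + 1)" "(\<lambda>v. y v * n v) \<in> hform (1 + 1)"
      by (intro hform_mult xy a b)+
    then show "(\<lambda>v. x v * m v + y v * n v + k v) \<in> hform 2"
      using g(3) by (auto intro!: hform_add simp del: hform.simps simp: numeral_2_eq_2)
    show "f v = a1 * x v ^ 3 + (a2 + b1) * x v ^ 2 * y v + (a3 + b2) * x v * y v ^ 2 + b3 * y v ^ 3
        + z v * (x v * m v + y v * n v + k v)" for v
      unfolding g(4) a(2) b(2) by (simp add: algebra_simps power2_eq_square power3_eq_cube)
  qed
qed

text \<open>Passes from vanishing at one representative to vanishing on the whole projective
  point.\<close>

lemma hform_homogeneous: "f \<in> hform d \<Longrightarrow> f (k *s v) = k ^ d * f v"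
proof (induction d arbitrary: f)
  case (Suc d)
  then obtain g where g: "\<And>i. g i \<in> hform d" "f = (\<lambda>v. \<Sum>i\<in>UNIV. v $ i * g i v)" by auto
  show ?case by (simp add: g(2) Suc.IH[OF g(1)] sum_distrib_left mult_ac)
qed auto

subsection \<open>The Cayley--Bacharach theorem\<close>

lemma three_independent_span:
  fixes p q w :: "'a::field ^ 3"
  assumes "q \<noteq> 0" "p \<notin> vec.span {q}" "w \<notin> vec.span {p, q}"
  obtains r s t where "v = s *s p + t *s q + r *s w"
proof -
  have "p \<noteq> q" "w \<noteq> p" "w \<noteq> q"
    using assms by (auto simp: vec.span_base)
  moreover have "vec.independent {w, p, q}"
    using assms by (auto simp: vec.independent_insert)
  ultimately have "UNIV \<subseteq> vec.span {w, p, q}"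
    by (intro vec.card_ge_dim_independent) (auto simp: vec_dim_card simp del: vec.dim_UNIV)
  then obtain r s t where "v - r *s w - s *s p = t *s q"
    using vec.span_breakdown_eq[of v w] vec.span_breakdown_eq[of _ p "{q}"]
    by (fastforce simp: vec.span_singleton)
  then have "v = s *s p + t *s q + r *s w" by (simp add: algebra_simps)
  then show ?thesis by (rule that)
qed

text \<open>\<open>B1\<close> and \<open>B2\<close> separate \<open>p\<close> from \<open>q\<close>,
  and \<open>R\<close> separates \<open>w\<close> from their line, so the three vectors form a
  basis. Applying \<open>R\<close> to the decomposition of \<open>v\<close> shows that the third
  coordinate is \<open>R v / R w\<close>.\<close>

lemma line_coordinates:
  assumes "R \<in> hform 1" "B1 \<in> hform 1" "B2 \<in> hform 1"
    and R: "R p = 0" "R q = 0" "R w \<noteq> 0"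
    and B: "B1 p = 0" "B1 q \<noteq> 0" "B2 q = 0" "B2 p \<noteq> 0"
  obtains x y where "x \<in> hform 1" "y \<in> hform 1" "x p = 1" "x q = 0" "y p = 0" "y q = 1"
    "\<And>v. v = x v *s p + y v *s q + (R v / R w) *s w"
proof -
  note lin = hform_1_linear[OF assms(1)] hform_1_linear[OF assms(2)] hform_1_linear[OF assms(3)]
  have z: "R 0 = 0" "B1 0 = 0" "B2 0 = 0"
    using lin(2)[of 0 0] lin(4)[of 0 0] lin(6)[of 0 0] by simp_all
  have p: "p \<notin> vec.span {q}" "q \<noteq> 0"
    using B lin z by (auto simp: vec.span_singleton)
  have w: "w \<notin> vec.span {p, q}"
  proof
    assume "w \<in> vec.span {p, q}"
    then obtain s t where "w - s *s p = t *s q"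
      by (auto simp: vec.span_breakdown_eq[of w p] vec.span_singleton)
    then have "w = s *s p + t *s q" by (simp add: algebra_simps)
    then show False using R lin by simp
  qed
  \<comment> \<open>\<open>B2\<close> already vanishes at \<open>q\<close>; subtracting a multiple
    of \<open>R\<close> makes it vanish at \<open>w\<close>, and the last factor gives it value 1 at
    \<open>p\<close>. Likewise for \<open>y\<close> and \<open>B1\<close>.\<close>
  define x where "x v = (B2 v - R v * (B2 w / R w)) * (1 / B2 p)" for v
  define y where "y v = (B1 v - R v * (B1 w / R w)) * (1 / B1 q)" for v
  have "v = x v *s p + y v *s q + (R v / R w) *s w" for v
  proof -
    obtain r s t where v: "v = s *s p + t *s q + r *s w"
      using three_independent_span[OF p(2,1) w] .
    have "R v / R w = r" "x v = s" "y v = t"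
      using R B lin unfolding v x_def y_def by auto
    then show ?thesis using v by simp
  qed
  moreover have "x \<in> hform 1" "y \<in> hform 1"
    unfolding x_def[abs_def] y_def[abs_def]
    by (intro hform_scale' hform_diff assms(1-3))+
  moreover have "x p = 1" "x q = 0" "y p = 0" "y q = 1"
    using R B by (simp_all add: x_def y_def)
  ultimately show ?thesis using that by blast
qed

text \<open>On \<open>R = 0\<close> the conic is a binary quadratic form with three distinct
  projective zeros, hence has zero coefficients; what is left is a multiple of
  \<open>R\<close>.\<close>

lemma quadratic_on_line:
  assumes f: "f \<in> hform 2" "f p = 0" "f q = 0" "f r = 0"
    and hf: "R \<in> hform 1" "B1 \<in> hform 1" "B2 \<in> hform 1"
    and R: "R p = 0" "R q = 0" "R r = 0" "R w \<noteq> 0"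
    and B: "B1 p = 0" "B1 q \<noteq> 0" "B1 r \<noteq> 0" "B2 q = 0" "B2 p \<noteq> 0" "B2 r \<noteq> 0"
  obtains g where "g \<in> hform 1" "\<And>v. f v = R v * g v"
proof -
  obtain x y where xy: "x \<in> hform 1" "y \<in> hform 1" "x p = 1" "x q = 0" "y p = 0" "y q = 1"
    "\<And>v. v = x v *s p + y v *s q + (R v / R w) *s w"
    using line_coordinates[OF hf R(1,2,4) B(1,2,4,5)] by metis
  obtain a b c g where g: "g \<in> hform 1"
      "\<And>v. f v = a * x v ^ 2 + b * x v * y v + c * y v ^ 2 + R v / R w * g v"
    using quadratic_expand[OF f(1) xy(7,1,2)] by metis
  have ac: "a = 0" "c = 0"
    using g(2)[of p] g(2)[of q] f R xy(3-6) by simp_all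
  have r: "r = x r *s p + y r *s q" using xy(7)[of r] R(3) by simp
  \<comment> \<open>By the decomposition of \<open>r\<close>, \<open>B1 r = y r * B1 q\<close> and
    \<open>B2 r = x r * B2 p\<close>.\<close>
  have "x r \<noteq> 0" "y r \<noteq> 0"
    using B hform_1_linear[OF hf(2)] hform_1_linear[OF hf(3)]
    by (metis r add_0 mult_zero_left mult_zero_right add.right_neutral)+
  then have "b = 0" using g(2)[of r] f R ac by simp
  show ?thesis
  proof (rule that)
    show "(\<lambda>v. 1 / R w * g v) \<in> hform 1" by (rule hform_scale[OF g(1)])
    show "f v = R v * (1 / R w * g v)" for v using g(2)[of v] ac \<open>b = 0\<close> by simp
  qed
qed

text \<open>Binary cubic forms with three prescribed distinct zeros are unique up to scalar, and
  \<open>B1 B2 B3\<close> restricts to a nonzero such form on \<open>R = 0\<close>. So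
  \<open>f\<close> differs from a multiple of it by a multiple of \<open>R\<close>.\<close>

lemma cubic_on_line:
  assumes f: "f \<in> hform 3" "f p = 0" "f q = 0" "f r = 0"
    and hf: "R \<in> hform 1" "B1 \<in> hform 1" "B2 \<in> hform 1" "B3 \<in> hform 1"
    and R: "R p = 0" "R q = 0" "R r = 0" "R w \<noteq> 0"
    and B: "B1 p = 0" "B1 q \<noteq> 0" "B1 r \<noteq> 0" "B2 q = 0" "B2 p \<noteq> 0" "B2 r \<noteq> 0"
      "B3 r = 0" "B3 p \<noteq> 0"
  obtains k g where "g \<in> hform 2" "\<And>v. f v = k * (B1 v * B2 v * B3 v) + R v * g v"
proof -
  note lin = hform_1_linear[OF hf(2)] hform_1_linear[OF hf(3)] hform_1_linear[OF hf(4)]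
  obtain x y where xy: "x \<in> hform 1" "y \<in> hform 1" "x p = 1" "x q = 0" "y p = 0" "y q = 1"
    "\<And>v. v = x v *s p + y v *s q + (R v / R w) *s w"
    using line_coordinates[OF hf(1-3) R(1,2,4) B(1,2,4,5)] by metis
  obtain a b c d g where g: "g \<in> hform 2"
      "\<And>v. f v = a * x v ^ 3 + b * x v ^ 2 * y v + c * x v * y v ^ 2 + d * y v ^ 3 + R v / R w * g v"
    using cubic_expand[OF f(1) xy(7,1,2)] by metis
  have ad: "a = 0" "d = 0"
    using g(2)[of p] g(2)[of q] f R xy(3-6) by simp_all
  have r: "r = x r *s p + y r *s q" using xy(7)[of r] R(3) by simp
  have nz: "x r \<noteq> 0" "y r \<noteq> 0"
    using B lin by (metis r add_0 mult_zero_left mult_zero_right add.right_neutral)+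
  have "x r * y r * (b * x r + c * y r) = 0"
    using g(2)[of r] f R ad by (simp add: algebra_simps power2_eq_square)
  then have bc: "b * x r + c * y r = 0" using nz by simp
  have "B3 r = x r * B3 p + y r * B3 q" by (subst r) (simp add: lin)
  then have B3: "x r * B3 p + y r * B3 q = 0" using B by simp
  \<comment> \<open>On \<open>R = 0\<close> the product \<open>B1 B2 B3\<close> is
    \<open>x * y * B1 q * B2 p * (x * B3 p + y * B3 q)\<close>; \<open>k\<close> matches the
    coefficients of \<open>x^2 * y\<close>.\<close>
  define k where "k = b / (B1 q * B2 p * B3 p)"
  have b: "b = k * B1 q * B2 p * B3 p" using B by (simp add: k_def)
  \<comment> \<open>Both \<open>(b, c)\<close> and \<open>(B3 p, B3 q)\<close> annihilate
    \<open>(x r, y r)\<close>, so they are proportional and the coefficients of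
    \<open>x * y^2\<close> match too.\<close>
  have "y r * c = y r * (k * B1 q * B2 p * B3 q)"
    using bc B3 b by algebra
  then have c: "c = k * B1 q * B2 p * B3 q" using nz by simp
  \<comment> \<open>With \<open>z = R v / R w\<close>, \<open>e\<close> is the cofactor of
    \<open>z\<close> when \<open>z\<close> is split off \<open>B1\<close>, \<open>B2\<close>,
    \<open>B3\<close> in turn.\<close>
  define e where "e v = B1 w * (B2 v * B3 v) + B1 q * B2 w * (y v * B3 v)
    + B1 q * B2 p * B3 w * (x v * y v)" for v
  have "(\<lambda>v. B1 w * (B2 v * B3 v) + B1 q * B2 w * (y v * B3 v)
    + B1 q * B2 p * B3 w * (x v * y v)) \<in> hform (1 + 1)"
    by (intro hform_add hform_scale hform_mult hf xy)
  then have e: "e \<in> hform 2" by (simp add: e_def[abs_def] numeral_2_eq_2 del: hform.simps)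
  show ?thesis
  proof (rule that)
    show "(\<lambda>v. 1 / R w * (g v - k * e v)) \<in> hform 2"
      by (intro hform_scale hform_diff g e)
    show "f v = k * (B1 v * B2 v * B3 v) + R v * (1 / R w * (g v - k * e v))" for v
    proof -
      define z where "z = R v / R w"
      have v: "v = x v *s p + y v *s q + z *s w" unfolding z_def by (rule xy)
      have "B1 v = y v * B1 q + z * B1 w" "B2 v = x v * B2 p + z * B2 w"
        "B3 v = x v * B3 p + y v * B3 q + z * B3 w"
        using B by (subst v; simp add: lin)+
      moreover have "f v = b * x v ^ 2 * y v + c * x v * y v ^ 2 + z * g v"
        using g(2)[of v] ad by (simp add: z_def)
      ultimately have "f v = k * (B1 v * B2 v * B3 v) + z * (g v - k * e v)"
        unfolding e_def b c by algebra
      then show ?thesis by (simp add: z_def)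
    qed
  qed
qed

text \<open>On the line \<open>R1\<close> the cubic is a multiple of \<open>B1 B2 B3\<close>, so \<open>f = k B1 B2 B3 + R1 q\<close>; the conic \<open>q\<close> then has
  three zeros on \<open>R2\<close>, so \<open>q = R2 l\<close>, and the linear form \<open>l\<close> vanishes at two points of \<open>R3\<close>.\<close>

lemma cayley_bacharach:
  assumes f: "f \<in> hform 3" "f p11 = 0" "f p12 = 0" "f p13 = 0" "f p21 = 0" "f p22 = 0" "f p23 = 0"
      "f p31 = 0" "f p32 = 0"
    and hf: "R1 \<in> hform 1" "R2 \<in> hform 1" "R3 \<in> hform 1"
      "B1 \<in> hform 1" "B2 \<in> hform 1" "B3 \<in> hform 1"
    and R1: "R1 p11 = 0" "R1 p12 = 0" "R1 p13 = 0" "R1 p21 \<noteq> 0" "R1 p22 \<noteq> 0" "R1 p23 \<noteq> 0"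
      "R1 p31 \<noteq> 0" "R1 p32 \<noteq> 0"
    and R2: "R2 p21 = 0" "R2 p22 = 0" "R2 p23 = 0" "R2 p31 \<noteq> 0" "R2 p32 \<noteq> 0"
    and R3: "R3 p31 = 0" "R3 p32 = 0" "R3 p33 = 0" "R3 p11 \<noteq> 0"
    and B1: "B1 p11 = 0" "B1 p12 \<noteq> 0" "B1 p13 \<noteq> 0" "B1 p21 = 0" "B1 p22 \<noteq> 0" "B1 p23 \<noteq> 0"
      "B1 p31 = 0" "B1 p32 \<noteq> 0"
    and B2: "B2 p11 \<noteq> 0" "B2 p12 = 0" "B2 p13 \<noteq> 0" "B2 p21 \<noteq> 0" "B2 p22 = 0" "B2 p23 \<noteq> 0"
      "B2 p31 \<noteq> 0" "B2 p32 = 0"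
    and B3: "B3 p11 \<noteq> 0" "B3 p13 = 0" "B3 p23 = 0" "B3 p33 = 0"
  shows "f p33 = 0"
proof -
  obtain k q where q: "q \<in> hform 2" "\<And>v. f v = k * (B1 v * B2 v * B3 v) + R1 v * q v"
    using cubic_on_line[OF f(1-4) hf(1,4-6) R1(1-4) B1(1-3) B2(2,1,3) B3(2,1)] by metis
  \<comment> \<open>At each of these points a column form vanishes and \<open>R1\<close> does
    not.\<close>
  have "q p21 = 0" "q p22 = 0" "q p23 = 0"
    using q(2)[of p21] q(2)[of p22] q(2)[of p23] f R1 B1 B2 B3 by auto
  then obtain l where l: "l \<in> hform 1" "\<And>v. q v = R2 v * l v"
    using quadratic_on_line[OF q(1) _ _ _ hf(2,4,5) R2(1-4) B1(4-6) B2(5,4,6)] by metis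
  have l0: "l p31 = 0" "l p32 = 0"
    using q(2)[of p31] q(2)[of p32] l(2)[of p31] l(2)[of p32] f R1 R2 B1 B2 by auto
  \<comment> \<open>\<open>p11\<close> serves as the point off \<open>R3\<close>; hence
    \<open>p33\<close> is a combination of \<open>p31\<close> and \<open>p32\<close>, where
    \<open>l\<close> vanishes.\<close>
  obtain x y where "\<And>v. v = x v *s p31 + y v *s p32 + (R3 v / R3 p11) *s p11"
    using line_coordinates[OF hf(3-5) R3(1,2,4) B1(7,8) B2(8,7)] by metis
  then have "p33 = x p33 *s p31 + y p33 *s p32"
    using R3 by (metis add.right_neutral div_0 vec.scale_zero_left)
  then have "l p33 = 0"
    using l0 hform_1_linear[OF l(1)] by (metis add_0 mult_zero_right)
  then show ?thesis using q(2) l(2) B3 by simp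
qed

subsection \<open>Cubics through nine points\<close>

text \<open>Gaussian elimination, by induction on the number of equations.\<close>

lemma underdetermined_system:
  fixes t :: "'n \<Rightarrow> 'm \<Rightarrow> 'a::field"
  assumes "finite N" "finite M" "card N < card M"
  shows "\<exists>c. (\<exists>m\<in>M. c m \<noteq> 0) \<and> (\<forall>n\<in>N. (\<Sum>m\<in>M. c m * t n m) = 0)"
  using assms
proof (induction N arbitrary: M t rule: finite_induct)
  case empty
  then obtain m where "m \<in> M" by fastforce
  then show ?case by (intro exI[of _ "\<lambda>_. 1"]) auto
next
  case (insert n N)
  show ?case
  proof (cases "\<forall>m\<in>M. t n m = 0")
    case True
    have "card N < card M" using insert by simp
    then obtain c where "\<exists>m\<in>M. c m \<noteq> 0" "\<forall>n\<in>N. (\<Sum>m\<in>M. c m * t n m) = 0"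
      using insert.IH[of M t] insert.prems by blast
    then show ?thesis using True by (intro exI[of _ c]) auto
  next
    case False
    then obtain m0 where m0: "m0 \<in> M" "t n m0 \<noteq> 0" by blast
    \<comment> \<open>Subtract from row \<open>k\<close> the multiple of row \<open>n\<close> that
      clears column \<open>m0\<close>.\<close>
    define t' where "t' k m = t k m - t k m0 * t n m / t n m0" for k m
    have "card N < card (M - {m0})" "finite (M - {m0})"
      using insert m0 by auto
    then obtain c where c: "\<exists>m\<in>M - {m0}. c m \<noteq> 0"
        "\<forall>n\<in>N. (\<Sum>m\<in>M - {m0}. c m * t' n m) = 0"
      using insert.IH[of "M - {m0}" t'] by blast
    define s where "s = (\<Sum>m\<in>M - {m0}. c m * t n m)"
    \<comment> \<open>Back substitution: equation \<open>n\<close> is solved for the unknown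
      \<open>m0\<close>.\<close>
    define c' where "c' = c(m0 := - s / t n m0)"
    have split: "(\<Sum>m\<in>M. c' m * t k m) = - s / t n m0 * t k m0 + (\<Sum>m\<in>M - {m0}. c m * t k m)" for k
      using insert.prems m0 by (subst sum.remove[of _ m0]) (auto simp: c'_def intro: sum.cong)
    have "(\<Sum>m\<in>M. c' m * t k m) = 0" if "k \<in> N" for k
    proof -
      have "(\<Sum>m\<in>M - {m0}. c m * t k m) =
          (\<Sum>m\<in>M - {m0}. c m * t' k m + t k m0 / t n m0 * (c m * t n m))"
        by (rule sum.cong) (auto simp: t'_def field_simps)
      also have "\<dots> = t k m0 / t n m0 * s"
        using c(2) that by (simp add: sum.distrib s_def sum_distrib_left)
      finally show ?thesis by (simp add: split)
    qed
    moreover have "(\<Sum>m\<in>M. c' m * t n m) = 0"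
      using m0 by (simp add: split s_def)
    moreover have "\<exists>m\<in>M. c' m \<noteq> 0" using c(1) by (auto simp: c'_def)
    ultimately show ?thesis by blast
  qed
qed

lemma eval_poly3_hform: "homogeneous3 d p \<Longrightarrow> eval_poly3 p \<in> hform d"
  unfolding eval_poly3_def[abs_def] homogeneous3_def
  by (intro hform_sum hform_scale hform_monomial) auto

lemma cubic_through_nine_points:
  fixes V :: "('a::field ^ 3) set"
  assumes "finite V" "card V < 10"
  obtains p :: "'a poly3" where "p \<noteq> 0" "homogeneous3 3 p" "\<And>v. v \<in> V \<Longrightarrow> eval_poly3 p v = 0"
proof -
  \<comment> \<open>A cubic monomial is given by its first two exponents. On \<open>I\<close> one
    has \<open>i + j \<le> 3\<close>, so the truncated subtraction is exact there and the total
    degree is 3.\<close>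
  define e :: "nat \<times> nat \<Rightarrow> 3 \<Rightarrow>\<^sub>0 nat" where
    "e = (\<lambda>(i, j). Poly_Mapping.single 1 i + Poly_Mapping.single 2 j + Poly_Mapping.single 3 (3 - i - j))"
  define I where "I = (SIGMA i:{..3::nat}. {..3 - i})"
  define M where "M = e ` I"
  have e: "Poly_Mapping.lookup (e (i, j)) 1 = i" "Poly_Mapping.lookup (e (i, j)) 2 = j"
    "Poly_Mapping.lookup (e (i, j)) 3 = 3 - i - j" for i j
    by (simp_all add: e_def lookup_add lookup_single)
  have "inj e" by (rule injI) (metis e(1,2) surj_pair)
  then have "card M = card I" by (simp add: M_def card_image inj_on_subset)
  also have "\<dots> = 10" by (simp add: I_def eval_nat_numeral)
  finally have "card M = 10" .
  moreover have M: "finite M" by (simp add: M_def I_def)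
  ultimately obtain c where c: "\<exists>m\<in>M. c m \<noteq> 0"
      "\<forall>v\<in>V. (\<Sum>m\<in>M. c m * (\<Prod>i\<in>UNIV. (v $ i) ^ Poly_Mapping.lookup m i)) = 0"
    using underdetermined_system[of V M "\<lambda>v m. \<Prod>i\<in>UNIV. (v $ i) ^ Poly_Mapping.lookup m i"]
      assms by auto
  define p where "p = Abs_poly_mapping (\<lambda>m. if m \<in> M then c m else 0)"
  have p: "Poly_Mapping.lookup p m = (if m \<in> M then c m else 0)" for m
    unfolding p_def by (subst Abs_poly_mapping_inverse) (use M in auto)
  have keys: "Poly_Mapping.keys p \<subseteq> M"
    by (auto simp: in_keys_iff p split: if_splits)
  show ?thesis
  proof (rule that)
    show "p \<noteq> 0" using c(1) p by (metis lookup_zero)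
    have "(\<Sum>i\<in>UNIV. Poly_Mapping.lookup m i) = 3" if "m \<in> M" for m
      using that by (auto simp: M_def I_def sum_3 e)
    then show "homogeneous3 3 p" using keys by (auto simp: homogeneous3_def)
    show "eval_poly3 p v = 0" if "v \<in> V" for v
    proof -
      have "eval_poly3 p v =
          (\<Sum>m\<in>M. Poly_Mapping.lookup p m * (\<Prod>i\<in>UNIV. (v $ i) ^ Poly_Mapping.lookup m i))"
        unfolding eval_poly3_def using M keys
        by (intro sum.mono_neutral_left) (auto simp: in_keys_iff)
      also have "\<dots> = 0" using c(2) that by (simp add: p)
      finally show ?thesis .
    qed
  qed
qed

subsection \<open>Labelled nets of order four\<close>

text \<open>\<open>l i j\<close> is an equation of the line joining \<open>a i\<close> and
  \<open>b j\<close>. The geometry is reduced to which points of the net are zeros of these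
  forms.\<close>

locale labelled_net =
  fixes a b c :: "nat \<Rightarrow> 'a::field ^ 3" and l :: "nat \<Rightarrow> nat \<Rightarrow> 'a ^ 3 \<Rightarrow> 'a" and L :: "nat \<Rightarrow> nat \<Rightarrow> nat"
  assumes l: "i < 4 \<Longrightarrow> j < 4 \<Longrightarrow> l i j \<in> hform 1"
    and l_a: "i < 4 \<Longrightarrow> j < 4 \<Longrightarrow> k < 4 \<Longrightarrow> l i j (a k) = 0 \<longleftrightarrow> k = i"
    and l_b: "i < 4 \<Longrightarrow> j < 4 \<Longrightarrow> k < 4 \<Longrightarrow> l i j (b k) = 0 \<longleftrightarrow> k = j"
    and l_c: "i < 4 \<Longrightarrow> j < 4 \<Longrightarrow> k < 4 \<Longrightarrow> l i j (c k) = 0 \<longleftrightarrow> k = L i j"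
    and L_less: "i < 4 \<Longrightarrow> j < 4 \<Longrightarrow> L i j < 4"
    and L_row: "i < 4 \<Longrightarrow> j < 4 \<Longrightarrow> j' < 4 \<Longrightarrow> L i j = L i j' \<longleftrightarrow> j = j'"
    and L_col: "i < 4 \<Longrightarrow> i' < 4 \<Longrightarrow> j < 4 \<Longrightarrow> L i j = L i' j \<longleftrightarrow> i = i'"
    and L_0_left: "j < 4 \<Longrightarrow> L 0 j = j"
    and L_0_right: "i < 4 \<Longrightarrow> L i 0 = i"
begin

text \<open>The grid has rows \<open>a\<^bsub>i1\<^esub> b\<^bsub>j1\<^esub> c\<^sub>1\<close>, \<open>b\<^bsub>j2\<^esub> c\<^sub>2 a\<^bsub>i2\<^esub>\<close>, \<open>c\<^sub>3 a\<^bsub>i3\<^esub> b\<^bsub>j3\<^esub>\<close>, where \<open>c\<^sub>s\<close> is the third point on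
  \<open>a\<^bsub>is\<^esub> b\<^bsub>js\<^esub>\<close>; the three equations on \<open>L\<close> say that its columns are collinear too.\<close>

context
  fixes f i1 i2 i3 j1 j2 j3
  assumes f: "f \<in> hform 3"
    and i: "i1 < 4" "i2 < 4" "i3 < 4" "i1 \<noteq> i2" "i1 \<noteq> i3" "i2 \<noteq> i3"
    and j: "j1 < 4" "j2 < 4" "j3 < 4" "j1 \<noteq> j2" "j1 \<noteq> j3" "j2 \<noteq> j3"
    and L: "L i2 j3 = L i1 j1" "L i3 j1 = L i2 j2" "L i1 j2 = L i3 j3"
    and f0: "f (a i1) = 0" "f (a i2) = 0" "f (a i3) = 0" "f (b j1) = 0" "f (b j2) = 0"
      "f (c (L i1 j1)) = 0" "f (c (L i2 j2)) = 0"
begin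

text \<open>The column equations move each pair of entries into a common row or column of
  \<open>L\<close>, where entries differ.\<close>

lemma grid_L_distinct:
  "L i1 j1 \<noteq> L i2 j2" "L i1 j1 \<noteq> L i3 j3" "L i2 j2 \<noteq> L i3 j3"
  using i j L L_col[of i3 i1 j1] L_row[of i1 j1 j2] L_row[of i3 j1 j3]
  by auto

lemmas grid_simps = i j i(4-6)[symmetric] j(4-6)[symmetric] L l_a l_b l_c L_less grid_L_distinct
  grid_L_distinct[symmetric]

lemma grid_b: "f (c (L i3 j3)) = 0 \<Longrightarrow> f (b j3) = 0"
  by (rule cayley_bacharach[where f = f and ?R1.0 = "l i1 j1" and ?R2.0 = "l i2 j2" and ?R3.0 = "l i3 j3"
    and ?B1.0 = "l i1 j2" and ?B2.0 = "l i3 j1" and ?B3.0 = "l i2 j3"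
    and ?p11.0 = "a i1" and ?p12.0 = "b j1" and ?p13.0 = "c (L i1 j1)"
    and ?p21.0 = "b j2" and ?p22.0 = "c (L i2 j2)" and ?p23.0 = "a i2"
    and ?p31.0 = "c (L i3 j3)" and ?p32.0 = "a i3"])
    (simp_all add: grid_simps f f0 l del: One_nat_def)

text \<open>The same grid with its first and third columns exchanged, so that the ninth point is the
  one on the third row labelled by \<open>c\<close>.\<close>

lemma grid_c: "f (b j3) = 0 \<Longrightarrow> f (c (L i3 j3)) = 0"
  by (rule cayley_bacharach[where f = f and ?R1.0 = "l i1 j1" and ?R2.0 = "l i2 j2" and ?R3.0 = "l i3 j3"
    and ?B3.0 = "l i1 j2" and ?B2.0 = "l i3 j1" and ?B1.0 = "l i2 j3"
    and ?p13.0 = "a i1" and ?p12.0 = "b j1" and ?p11.0 = "c (L i1 j1)"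
    and ?p23.0 = "b j2" and ?p22.0 = "c (L i2 j2)" and ?p21.0 = "a i2"
    and ?p31.0 = "b j3" and ?p32.0 = "a i3"])
    (simp_all add: grid_simps f f0 l del: One_nat_def)

end

text \<open>The first table is the Klein four-group; the others are the cyclic group, with 1, 2 or 3
  as the involution.\<close>

lemma reduced_latin_square:
  obtains
    "L 1 1 = 0" "L 1 2 = 3" "L 1 3 = 2" "L 2 1 = 3" "L 2 2 = 0" "L 2 3 = 1" "L 3 1 = 2" "L 3 2 = 1" "L 3 3 = 0"
  | "L 1 1 = 0" "L 1 2 = 3" "L 1 3 = 2" "L 2 1 = 3" "L 2 2 = 1" "L 2 3 = 0" "L 3 1 = 2" "L 3 2 = 0" "L 3 3 = 1"
  | "L 1 1 = 2" "L 1 2 = 3" "L 1 3 = 0" "L 2 1 = 3" "L 2 2 = 0" "L 2 3 = 1" "L 3 1 = 0" "L 3 2 = 1" "L 3 3 = 2"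
  | "L 1 1 = 3" "L 1 2 = 0" "L 1 3 = 2" "L 2 1 = 0" "L 2 2 = 3" "L 2 3 = 1" "L 3 1 = 2" "L 3 2 = 1" "L 3 3 = 0"
proof -
  have v: "L i j = 0 \<or> L i j = 1 \<or> L i j = 2 \<or> L i j = 3" if "i < 4" "j < 4" for i j
    using L_less[OF that] by linarith
  note r = v[of 1 1] v[of 1 2] v[of 1 3] v[of 2 1] v[of 2 2] v[of 2 3] v[of 3 1] v[of 3 2] v[of 3 3]
  have 0: "L 1 0 = 1" "L 2 0 = 2" "L 3 0 = 3" "L 0 1 = 1" "L 0 2 = 2" "L 0 3 = 3" using L_0_left L_0_right by auto
  note rows = L_row[of 1 0 1] L_row[of 1 0 2] L_row[of 1 0 3] L_row[of 1 1 2] L_row[of 1 1 3] L_row[of 1 2 3]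
    L_row[of 2 0 1] L_row[of 2 0 2] L_row[of 2 0 3] L_row[of 2 1 2] L_row[of 2 1 3] L_row[of 2 2 3]
    L_row[of 3 0 1] L_row[of 3 0 2] L_row[of 3 0 3] L_row[of 3 1 2] L_row[of 3 1 3] L_row[of 3 2 3]
    L_col[of 0 1 1] L_col[of 0 2 1] L_col[of 0 3 1] L_col[of 1 2 1] L_col[of 1 3 1] L_col[of 2 3 1]
    L_col[of 0 1 2] L_col[of 0 2 2] L_col[of 0 3 2] L_col[of 1 2 2] L_col[of 1 3 2] L_col[of 2 3 2]
    L_col[of 0 1 3] L_col[of 0 2 3] L_col[of 0 3 3] L_col[of 1 2 3] L_col[of 1 3 3] L_col[of 2 3 3]
  \<comment> \<open>Comparison with the first row and column excludes the values \<open>i\<close>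
    and \<open>j\<close> for \<open>L i j\<close>.\<close>
  have "(L 1 1 = 0 \<or> L 1 1 = 2 \<or> L 1 1 = 3)" "L 1 2 = 0 \<or> L 1 2 = 3" "L 1 3 = 0 \<or> L 1 3 = 2"
    "L 2 1 = 0 \<or> L 2 1 = 3" "L 2 2 = 0 \<or> L 2 2 = 1 \<or> L 2 2 = 3" "L 2 3 = 0 \<or> L 2 3 = 1"
    "L 3 1 = 0 \<or> L 3 1 = 2" "L 3 2 = 0 \<or> L 3 2 = 1" "L 3 3 = 0 \<or> L 3 3 = 1 \<or> L 3 3 = 2"
    using r rows unfolding 0 by simp_all
  moreover note rows
  ultimately show ?thesis using that by (simp, smt (verit))
qed

text \<open>The grids are listed as \<open>i1 i2 i3 j1 j2 j3\<close>. The first uses only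
  \<open>c 0\<close> and \<open>c 1\<close>, the second may use the point just found, and the third
  reaches \<open>b 3\<close>.\<close>

lemma grids_generate:
  assumes f: "f \<in> hform 3" and a: "\<And>i. i < 4 \<Longrightarrow> f (a i) = 0"
    and b: "\<And>j. j < 3 \<Longrightarrow> f (b j) = 0" and c: "f (c 0) = 0" "f (c 1) = 0"
  shows "f (b 3) = 0 \<and> f (c 2) = 0 \<and> f (c 3) = 0"
proof -
  note z = L_0_left L_0_right a b c c(2)[unfolded One_nat_def] f
  show ?thesis
  proof (rule reduced_latin_square, goal_cases)
    case 1
    have c3: "f (c 3) = 0" using grid_c[of f 2 0 3 2 1 0] 1 by (simp add: z)
    have c2: "f (c 2) = 0" using grid_c[of f 0 1 2 1 2 0] 1 c3 by (simp add: z)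
    show ?case using grid_b[of f 2 0 1 1 0 3] 1 c2 c3 by (simp add: z)
  next
    case 2
    have c2: "f (c 2) = 0" using grid_c[of f 2 0 3 2 0 1] 2 by (simp add: z)
    have c3: "f (c 3) = 0" using grid_c[of f 1 0 2 0 2 1] 2 c2 by (simp add: z)
    show ?case using grid_b[of f 2 0 1 1 0 3] 2 c2 c3 by (simp add: z)
  next
    case 3
    have c2: "f (c 2) = 0" using grid_c[of f 0 3 1 0 2 1] 3 by (simp add: z)
    have c3: "f (c 3) = 0" using grid_c[of f 1 0 2 0 2 1] 3 c2 by (simp add: z)
    show ?case using grid_b[of f 0 1 2 0 1 3] 3 c2 c3 by (simp add: z)
  next
    case 4
    have c2: "f (c 2) = 0" using grid_c[of f 0 1 2 1 2 0] 4 by (simp add: z)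
    have c3: "f (c 3) = 0" using grid_c[of f 1 0 3 2 1 0] 4 c2 by (simp add: z)
    show ?case using grid_b[of f 2 0 1 2 0 3] 4 c2 c3 by (simp add: z)
  qed
qed

end

text \<open>Fix \<open>P0\<close> and number \<open>B\<close> arbitrarily. Joining \<open>P0\<close>
  to \<open>b j\<close> numbers \<open>C\<close>, and joining \<open>b 0\<close> to
  \<open>c i\<close> numbers \<open>A\<close>; this puts the first row and column of
  \<open>L\<close> in natural order.\<close>

lemma latin_labelling:
  assumes card: "finite A" "card A = n" "finite B" "card B = n" "finite C" "card C = n" "n > 0"
    and AB: "\<And>P Q. P \<in> A \<Longrightarrow> Q \<in> B \<Longrightarrow> \<exists>!R. R \<in> C \<and> t P Q R"
    and AC: "\<And>P R. P \<in> A \<Longrightarrow> R \<in> C \<Longrightarrow> \<exists>!Q. Q \<in> B \<and> t P Q R"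
    and BC: "\<And>Q R. Q \<in> B \<Longrightarrow> R \<in> C \<Longrightarrow> \<exists>!P. P \<in> A \<and> t P Q R"
  obtains a b c L where
    "bij_betw a {..<n} A" "bij_betw b {..<n} B" "bij_betw c {..<n} C"
    "\<And>i j k. i < n \<Longrightarrow> j < n \<Longrightarrow> k < n \<Longrightarrow> t (a i) (b j) (c k) \<longleftrightarrow> k = L i j"
    "\<And>i j. i < n \<Longrightarrow> j < n \<Longrightarrow> L i j < n"
    "\<And>i j j'. i < n \<Longrightarrow> j < n \<Longrightarrow> j' < n \<Longrightarrow> L i j = L i j' \<longleftrightarrow> j = j'"
    "\<And>i i' j. i < n \<Longrightarrow> i' < n \<Longrightarrow> j < n \<Longrightarrow> L i j = L i' j \<longleftrightarrow> i = i'"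
    "\<And>j. j < n \<Longrightarrow> L 0 j = j" "\<And>i. i < n \<Longrightarrow> L i 0 = i"
proof -
  obtain b where b: "bij_betw b {..<n} B"
    using ex_bij_betw_nat_finite[OF card(3)] card(4) by (auto simp: atLeast0LessThan)
  obtain P0 where P0: "P0 \<in> A" using card by fastforce
  have bB: "j < n \<Longrightarrow> b j \<in> B" for j using b by (auto simp: bij_betw_def)
  have b_eq: "i < n \<Longrightarrow> j < n \<Longrightarrow> b i = b j \<longleftrightarrow> i = j" for i j
    using b by (auto simp: bij_betw_def inj_on_def)
  have "\<forall>j. \<exists>R. j < n \<longrightarrow> R \<in> C \<and> t P0 (b j) R" using AB[OF P0 bB] by blast
  then obtain c where c: "\<And>j. j < n \<Longrightarrow> c j \<in> C \<and> t P0 (b j) (c j)" by metis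
  have c_eq: "i < n \<Longrightarrow> j < n \<Longrightarrow> c i = c j \<longleftrightarrow> i = j" for i j
    using AC[OF P0] c bB b_eq by metis
  have c_bij: "bij_betw c {..<n} C"
    unfolding bij_betw_def
  proof
    show "inj_on c {..<n}" using c_eq by (auto simp: inj_on_def)
    then show "c ` {..<n} = C"
      using c card by (intro card_subset_eq) (auto simp: card_image)
  qed
  have "\<forall>i. \<exists>P. i < n \<longrightarrow> P \<in> A \<and> t P (b 0) (c i)" using BC[OF bB] c card(7) by blast
  then obtain a where a: "\<And>i. i < n \<Longrightarrow> a i \<in> A \<and> t (a i) (b 0) (c i)" by metis
  have a_eq: "i < n \<Longrightarrow> j < n \<Longrightarrow> a i = a j \<longleftrightarrow> i = j" for i j
    using AB[OF _ bB[OF card(7)]] a c c_eq by metis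
  have a_bij: "bij_betw a {..<n} A"
    unfolding bij_betw_def
  proof
    show "inj_on a {..<n}" using a_eq by (auto simp: inj_on_def)
    then show "a ` {..<n} = A"
      using a card by (intro card_subset_eq) (auto simp: card_image)
  qed
  \<comment> \<open>The two numberings agree: \<open>P0\<close> and \<open>a 0\<close> both complete
    \<open>b 0\<close> and \<open>c 0\<close>.\<close>
  have a0: "a 0 = P0"
    using BC[OF bB[OF card(7)], of "c 0"] a[OF card(7)] c[OF card(7)] P0 by blast
  have "\<exists>k<n. t (a i) (b j) (c k)" if "i < n" "j < n" for i j
  proof -
    obtain R where "R \<in> C" "t (a i) (b j) R" using AB a bB \<open>i < n\<close> \<open>j < n\<close> by blast
    then show ?thesis using c_bij by (metis bij_betw_imp_surj_on imageE lessThan_iff)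
  qed
  then obtain L where L: "\<And>i j. i < n \<Longrightarrow> j < n \<Longrightarrow> L i j < n \<and> t (a i) (b j) (c (L i j))"
    by metis
  have t: "t (a i) (b j) (c k) \<longleftrightarrow> k = L i j" if "i < n" "j < n" "k < n" for i j k
  proof -
    have "\<exists>!R. R \<in> C \<and> t (a i) (b j) R" using AB a bB that by simp
    moreover have "c k \<in> C" "c (L i j) \<in> C" "t (a i) (b j) (c (L i j))"
      using c L that by simp_all
    ultimately have "t (a i) (b j) (c k) \<longleftrightarrow> c k = c (L i j)" by metis
    then show ?thesis using c_eq L that by simp
  qed
  show ?thesis
  proof (rule that[OF a_bij b c_bij t])
    show "L i j < n" if "i < n" "j < n" for i j using L that by blast
    show "L i j = L i j' \<longleftrightarrow> j = j'" if "i < n" "j < n" "j' < n" for i j j'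
      using AC[of "a i" "c (L i j)"] a c bB b_eq L that by metis
    show "L i j = L i' j \<longleftrightarrow> i = i'" if "i < n" "i' < n" "j < n" for i i' j
      using BC[of "b j" "c (L i j)"] a c bB a_eq L that by metis
    show "L 0 j = j" if "j < n" for j
      using t[of 0 j j] c[OF that] card(7) that by (simp add: a0)
    show "L i 0 = i" if "i < n" for i
      using t[of i 0 i] a[OF that] card(7) that by simp
  qed
qed

subsection \<open>Dual 3-nets in the plane\<close>

lemma pg2_pointE:
  assumes "P \<in> pg2_points"
  obtains v where "v \<noteq> 0" "P = vec.span {v}"
proof -
  from assms have P: "vec.subspace P" "vec.dim P = 1" by (auto simp: pg2_points_def)
  obtain B where B: "B \<subseteq> P" "vec.independent B" "P \<subseteq> vec.span B" "card B = 1"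
    using vec.basis_exists[of P] P(2) by metis
  obtain v where "B = {v}" using B(4) by (auto simp: card_1_singleton_iff)
  moreover have "vec.span B = P" using B P by (metis vec.span_subspace)
  ultimately show ?thesis using that B(2) by auto
qed

lemma pg2_line_through:
  assumes "P \<in> pg2_points" "Q \<in> pg2_points" "P \<noteq> Q"
  obtains L where "L \<in> pg2_lines" "P \<subseteq> L" "Q \<subseteq> L"
    "\<And>L'. L' \<in> pg2_lines \<Longrightarrow> P \<subseteq> L' \<Longrightarrow> Q \<subseteq> L' \<Longrightarrow> L' = L"
proof -
  obtain p where p: "p \<noteq> 0" "P = vec.span {p}" using pg2_pointE[OF assms(1)] .
  obtain q where q: "q \<noteq> 0" "Q = vec.span {q}" using pg2_pointE[OF assms(2)] .
  have "q \<notin> P"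
  proof
    assume "q \<in> P"
    then have sub: "Q \<subseteq> P" unfolding p q by (simp add: vec.span_minimal)
    have "vec.span Q = vec.span P"
      using vec.dim_eq_span[OF sub] assms by (simp add: pg2_points_def)
    then show False using assms(3) p q by (simp add: vec.span_span)
  qed
  then have ind: "vec.independent {q, p}" "q \<noteq> p"
    using p by (auto simp: vec.independent_insert vec.span_base)
  let ?L = "vec.span {q, p}"
  have dim: "vec.dim ?L = 2"
    using vec.dim_eq_card_independent[OF ind(1)] ind(2) by (simp add: vec.dim_span)
  show ?thesis
  proof (rule that)
    show "?L \<in> pg2_lines" using dim by (simp add: pg2_lines_def)
    show "P \<subseteq> ?L" "Q \<subseteq> ?L" unfolding p q by (intro vec.span_mono; simp)+
    fix L' assume L': "L' \<in> pg2_lines" "P \<subseteq> L'" "Q \<subseteq> L'"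
    then have "vec.subspace L'" "vec.dim L' = 2" by (auto simp: pg2_lines_def)
    moreover have "{q, p} \<subseteq> L'" using L' p q vec.span_base by blast
    ultimately have "?L \<subseteq> L'" "vec.span ?L = vec.span L'"
      using vec.dim_eq_span[of ?L L'] dim by (auto simp: vec.span_minimal)
    then show "L' = ?L" using \<open>vec.subspace L'\<close> by (metis vec.span_eq_iff vec.span_span)
  qed
qed

lemma pg2_line_equation:
  assumes "L \<in> pg2_lines"
  obtains f where "f \<in> hform 1" "\<And>v. f v = 0 \<longleftrightarrow> v \<in> L"
proof -
  from assms have L: "vec.subspace L" "vec.dim L = 2" by (auto simp: pg2_lines_def)
  obtain B where B: "B \<subseteq> L" "vec.independent B" "L \<subseteq> vec.span B" "card B = 2"
    using vec.basis_exists[of L] L(2) by metis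
  obtain p q where pq: "B = {p, q}" "p \<noteq> q" using B(4) by (auto simp: card_2_iff)
  have span: "vec.span {p, q} = L" using B L pq by (metis vec.span_subspace)
  have ind: "p \<notin> vec.span {q}" "q \<noteq> 0"
    using B(2) pq by (auto simp: vec.independent_insert)
  \<comment> \<open>The cross product of \<open>p\<close> and \<open>q\<close>, so that
    \<open>f v\<close> is the determinant of \<open>v\<close>, \<open>p\<close>,
    \<open>q\<close>.\<close>
  define u where "u = (\<lambda>i :: 3. if i = 1 then p $ 2 * q $ 3 - p $ 3 * q $ 2
    else if i = 2 then p $ 3 * q $ 1 - p $ 1 * q $ 3 else p $ 1 * q $ 2 - p $ 2 * q $ 1)"
  define f where "f = (\<lambda>v :: 'a ^ 3. \<Sum>i\<in>UNIV. v $ i * u i)"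
  have f: "f \<in> hform 1" using hform_SucI[of "\<lambda>i v. u i" 0] by (auto simp: f_def)
  have fpq: "f p = 0" "f q = 0"
    by (simp_all add: f_def u_def sum_3 algebra_simps)
  \<comment> \<open>A vanishing cross product would make \<open>p\<close> a multiple of
    \<open>q\<close>.\<close>
  obtain w where w: "f w \<noteq> 0"
  proof (rule ccontr)
    assume "\<not> thesis"
    then have "f v = 0" for v using that by blast
    from this[of "axis 1 1"] this[of "axis 2 1"] this[of "axis 3 1"]
    have u: "p $ 2 * q $ 3 = p $ 3 * q $ 2" "p $ 3 * q $ 1 = p $ 1 * q $ 3" "p $ 1 * q $ 2 = p $ 2 * q $ 1"
      by (simp_all add: f_def u_def sum_3 axis_def)
    obtain k where k: "q $ k \<noteq> 0" using ind(2) by (auto simp: vec_eq_iff)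
    have "p $ i * q $ k = p $ k * q $ i" for i
      using u exhaust_3[of i] exhaust_3[of k] by auto
    then have "p = (p $ k / q $ k) *s q"
      using k by (simp add: vec_eq_iff field_simps)
    then show False using ind(1) by (auto simp: vec.span_singleton)
  qed
  note lin = hform_1_linear[OF f]
  have L_iff: "v \<in> L \<longleftrightarrow> (\<exists>s t. v = s *s p + t *s q)" for v
    unfolding span[symmetric] vec.span_breakdown_eq[of v p]
    by (simp add: vec.span_singleton image_iff diff_eq_eq add.commute)
  have "w \<notin> vec.span {p, q}"
    using w fpq lin by (auto simp: span L_iff)
  then have "f v = 0 \<longleftrightarrow> v \<in> L" for v
  proof -
    obtain r s t where v: "v = s *s p + t *s q + r *s w"
      using three_independent_span[OF ind(2,1) \<open>w \<notin> _\<close>] .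
    have "v \<in> L" if "f v = 0"
    proof -
      have "r = 0" using that w fpq by (simp add: v lin)
      then have "v = s *s p + t *s q" using v by simp
      then show ?thesis unfolding L_iff by blast
    qed
    moreover have "f v = 0" if "v \<in> L"
      using that fpq lin by (auto simp: L_iff)
    ultimately show ?thesis by blast
  qed
  with f that show ?thesis by blast
qed

lemma pg2_points_representatives:
  obtains rep where "\<And>P. P \<in> pg2_points \<Longrightarrow> P = vec.span {rep P :: 'a::field ^ 3}"
  by (metis pg2_pointE)

text \<open>Disjointness of \<open>X\<close> and \<open>Y\<close> gives both
  \<open>X \<noteq> Y\<close> and \<open>P \<noteq> Q\<close>, so the join exists and the net axiom
  applies to it.\<close>

lemma dual_3_net_join:
  assumes net: "dual_3_net n A B C"
    and XY: "X \<in> {A, B, C}" "Y \<in> {A, B, C}" "X \<inter> Y = {}" "P \<in> X" "Q \<in> Y"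
  obtains L where "L \<in> pg2_lines" "P \<subseteq> L" "Q \<subseteq> L"
    "\<And>L'. L' \<in> pg2_lines \<Longrightarrow> P \<subseteq> L' \<Longrightarrow> Q \<subseteq> L' \<Longrightarrow> L' = L"
    "\<And>Z. Z \<in> {A, B, C} \<Longrightarrow> \<exists>!R. R \<in> Z \<and> R \<subseteq> L"
proof -
  have "P \<in> pg2_points" "Q \<in> pg2_points" "P \<noteq> Q"
    using net XY unfolding dual_3_net_def by auto
  then obtain L where L: "L \<in> pg2_lines" "P \<subseteq> L" "Q \<subseteq> L"
    "\<And>L'. L' \<in> pg2_lines \<Longrightarrow> P \<subseteq> L' \<Longrightarrow> Q \<subseteq> L' \<Longrightarrow> L' = L"
    using pg2_line_through by metis
  have XY': "X \<noteq> Y" "meets L X" "meets L Y"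
    unfolding meets_def using XY(3-5) L(2,3) by blast+
  have "\<forall>L\<in>pg2_lines. \<forall>X\<in>{A, B, C}. \<forall>Y\<in>{A, B, C}.
      X \<noteq> Y \<and> meets L X \<and> meets L Y \<longrightarrow> (\<forall>Z\<in>{A, B, C}. \<exists>!P. P \<in> Z \<and> P \<subseteq> L)"
    using net unfolding dual_3_net_def by (elim conjE)
  from this[rule_format, OF L(1) XY(1,2) conjI[OF XY'(1) conjI[OF XY'(2,3)]]]
  have "\<exists>!P. P \<in> Z \<and> P \<subseteq> L" if "Z \<in> {A, B, C}" for Z
    using that by metis
  then show ?thesis by (intro that[OF L])
qed

text \<open>Collinearity with \<open>P\<close> and \<open>Q\<close> means lying on their unique
  join. This is the form of the axiom that \<open>latin_labelling\<close> takes.\<close>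

lemma dual_3_net_third_point:
  assumes net: "dual_3_net n A B C"
    and XY: "X \<in> {A, B, C}" "Y \<in> {A, B, C}" "X \<inter> Y = {}" "P \<in> X" "Q \<in> Y" and Z: "Z \<in> {A, B, C}"
  shows "\<exists>!R. R \<in> Z \<and> (\<exists>L\<in>pg2_lines. P \<subseteq> L \<and> Q \<subseteq> L \<and> R \<subseteq> L)"
proof -
  obtain L where L: "L \<in> pg2_lines" "P \<subseteq> L" "Q \<subseteq> L"
    "\<And>L'. L' \<in> pg2_lines \<Longrightarrow> P \<subseteq> L' \<Longrightarrow> Q \<subseteq> L' \<Longrightarrow> L' = L"
    "\<And>Z. Z \<in> {A, B, C} \<Longrightarrow> \<exists>!R. R \<in> Z \<and> R \<subseteq> L"
    by (rule dual_3_net_join[OF net XY]) (rule that; assumption)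
  have "(\<exists>L'\<in>pg2_lines. P \<subseteq> L' \<and> Q \<subseteq> L' \<and> R \<subseteq> L') \<longleftrightarrow> R \<subseteq> L" for R
    using L(1-4) by metis
  with L(5)[OF Z] show ?thesis by simp
qed

lemma dual_3_net_labelling:
  fixes A B C :: "('a::field ^ 3) set set"
  assumes net: "dual_3_net 4 A B C" and rep: "\<And>P. P \<in> pg2_points \<Longrightarrow> P = vec.span {rep P}"
  obtains a b c l L where "bij_betw a {..<4} A" "bij_betw b {..<4} B" "bij_betw c {..<4} C"
    "labelled_net (rep \<circ> a) (rep \<circ> b) (rep \<circ> c) l L"
proof -
  define t where "t P Q R \<longleftrightarrow> (\<exists>L\<in>pg2_lines. P \<subseteq> L \<and> Q \<subseteq> L \<and> R \<subseteq> L)" for P Q R :: "('a ^ 3) set"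
  have pts: "A \<subseteq> pg2_points" "B \<subseteq> pg2_points" "C \<subseteq> pg2_points"
    and disj: "A \<inter> B = {}" "A \<inter> C = {}" "B \<inter> C = {}"
    and card: "finite A" "card A = 4" "finite B" "card B = 4" "finite C" "card C = 4"
    using net by (auto simp: dual_3_net_def)
  have AB: "\<exists>!R. R \<in> C \<and> t P Q R" if "P \<in> A" "Q \<in> B" for P Q
    using dual_3_net_third_point[OF net _ _ disj(1) that, of C] unfolding t_def
    by (simp add: conj_ac)
  have AC: "\<exists>!Q. Q \<in> B \<and> t P Q R" if "P \<in> A" "R \<in> C" for P R
    using dual_3_net_third_point[OF net _ _ disj(2) that, of B] unfolding t_def
    by (simp add: conj_ac)
  have BC: "\<exists>!P. P \<in> A \<and> t P Q R" if "Q \<in> B" "R \<in> C" for Q R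
    using dual_3_net_third_point[OF net _ _ disj(3) that, of A] unfolding t_def
    by (simp add: conj_ac)
  have line: "\<exists>f\<in>hform 1. (\<forall>P'\<in>A. f (rep P') = 0 \<longleftrightarrow> P' = P) \<and> (\<forall>Q'\<in>B. f (rep Q') = 0 \<longleftrightarrow> Q' = Q)
      \<and> (\<forall>R\<in>C. f (rep R) = 0 \<longleftrightarrow> t P Q R)" if PQ: "P \<in> A" "Q \<in> B" for P Q
  proof -
    obtain L where L: "L \<in> pg2_lines" "P \<subseteq> L" "Q \<subseteq> L"
      "\<And>L'. L' \<in> pg2_lines \<Longrightarrow> P \<subseteq> L' \<Longrightarrow> Q \<subseteq> L' \<Longrightarrow> L' = L"
      "\<And>Z. Z \<in> {A, B, C} \<Longrightarrow> \<exists>!R. R \<in> Z \<and> R \<subseteq> L"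
      by (rule dual_3_net_join[OF net insertI1 insertI2[OF insertI1] disj(1) PQ]) (rule that; assumption)
    obtain f where f: "f \<in> hform 1" "\<And>v. f v = 0 \<longleftrightarrow> v \<in> L"
      by (rule pg2_line_equation[OF L(1)]) blast
    have "vec.subspace L" using L(1) by (simp add: pg2_lines_def)
    then have eq: "f (rep P') = 0 \<longleftrightarrow> P' \<subseteq> L" if "P' \<in> pg2_points" for P'
      using rep[OF that] f(2) vec.span_minimal[of "{rep P'}" L] vec.span_base[of "rep P'" "{rep P'}"]
      by auto
    have "f (rep P') = 0 \<longleftrightarrow> P' = P" if "P' \<in> A" for P'
      using eq[of P'] pts(1) that PQ L(2) L(5)[of A] by (metis insertI1 subsetD)
    moreover have "f (rep Q') = 0 \<longleftrightarrow> Q' = Q" if "Q' \<in> B" for Q'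
      using eq[of Q'] pts(2) that PQ L(3) L(5)[of B] by (metis insertI1 insertI2 subsetD)
    moreover have "f (rep R) = 0 \<longleftrightarrow> t P Q R" if "R \<in> C" for R
      using eq[of R] pts(3) that L(1-4) unfolding t_def by (metis subsetD)
    ultimately show ?thesis using f(1) by blast
  qed
  obtain a b c :: "nat \<Rightarrow> ('a ^ 3) set" and L :: "nat \<Rightarrow> nat \<Rightarrow> nat"
    where lab: "bij_betw a {..<4} A" "bij_betw b {..<4} B" "bij_betw c {..<4} C"
    and t: "\<And>i j k. i < 4 \<Longrightarrow> j < 4 \<Longrightarrow> k < 4 \<Longrightarrow> t (a i) (b j) (c k) \<longleftrightarrow> k = L i j"
    and L: "\<And>i j. i < 4 \<Longrightarrow> j < 4 \<Longrightarrow> L i j < 4"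
    "\<And>i j j'. i < 4 \<Longrightarrow> j < 4 \<Longrightarrow> j' < 4 \<Longrightarrow> L i j = L i j' \<longleftrightarrow> j = j'"
    "\<And>i i' j. i < 4 \<Longrightarrow> i' < 4 \<Longrightarrow> j < 4 \<Longrightarrow> L i j = L i' j \<longleftrightarrow> i = i'"
    "\<And>j. j < 4 \<Longrightarrow> L 0 j = j" "\<And>i. i < 4 \<Longrightarrow> L i 0 = i"
    by (rule latin_labelling[OF card _ AB AC BC]) (simp, assumption+, (rule that; assumption))
  have mem: "i < 4 \<Longrightarrow> a i \<in> A" "i < 4 \<Longrightarrow> b i \<in> B" "i < 4 \<Longrightarrow> c i \<in> C" for i
    using lab bij_betwE by blast+
  have inj: "i < 4 \<Longrightarrow> k < 4 \<Longrightarrow> a i = a k \<longleftrightarrow> i = k" "i < 4 \<Longrightarrow> k < 4 \<Longrightarrow> b i = b k \<longleftrightarrow> i = k" for i k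
    using lab inj_on_eq_iff[of a "{..<4}" i k] inj_on_eq_iff[of b "{..<4}" i k]
    by (simp_all add: bij_betw_def)
  \<comment> \<open>One equation is chosen for each join; its existence for indices below 4 is
    \<open>line\<close>.\<close>
  define l where "l i j = (SOME f. f \<in> hform 1 \<and> (\<forall>P'\<in>A. f (rep P') = 0 \<longleftrightarrow> P' = a i)
      \<and> (\<forall>Q'\<in>B. f (rep Q') = 0 \<longleftrightarrow> Q' = b j) \<and> (\<forall>R\<in>C. f (rep R) = 0 \<longleftrightarrow> t (a i) (b j) R))" for i j
  have l: "l i j \<in> hform 1" "\<And>P'. P' \<in> A \<Longrightarrow> l i j (rep P') = 0 \<longleftrightarrow> P' = a i"
      "\<And>Q'. Q' \<in> B \<Longrightarrow> l i j (rep Q') = 0 \<longleftrightarrow> Q' = b j"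
      "\<And>R. R \<in> C \<Longrightarrow> l i j (rep R) = 0 \<longleftrightarrow> t (a i) (b j) R"
    if "i < 4" "j < 4" for i j
    using someI_ex[OF line[OF mem(1)[OF that(1)] mem(2)[OF that(2)], unfolded Bex_def]]
    unfolding l_def by blast+
  have "labelled_net (rep \<circ> a) (rep \<circ> b) (rep \<circ> c) l L"
  proof
    fix i j k :: nat
    assume i: "i < 4" and j: "j < 4"
    show "l i j \<in> hform 1" by (rule l(1)[OF i j])
    assume k: "k < 4"
    show "l i j ((rep \<circ> a) k) = 0 \<longleftrightarrow> k = i" using l(2)[OF i j mem(1)[OF k]] inj(1)[OF k i] by simp
    show "l i j ((rep \<circ> b) k) = 0 \<longleftrightarrow> k = j" using l(3)[OF i j mem(2)[OF k]] inj(2)[OF k j] by simp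
    show "l i j ((rep \<circ> c) k) = 0 \<longleftrightarrow> k = L i j" using l(4)[OF i j mem(3)[OF k]] t[OF i j k] by simp
  qed (fact L)+
  with lab show ?thesis by (rule that)
qed

theorem theorem7:
  fixes A B C :: "('a::field ^ 3) set set"
  assumes "dual_3_net 4 A B C"
  shows "\<exists>p :: 'a poly3. p \<noteq> 0 \<and> homogeneous3 3 p \<and> (\<forall>P\<in>A \<union> B \<union> C. vanishes_at p P)"
proof -
  obtain rep where rep: "\<And>P. P \<in> pg2_points \<Longrightarrow> P = vec.span {rep P :: 'a ^ 3}"
    by (rule pg2_points_representatives) blast
  obtain a b c l L where lab: "bij_betw a {..<4} A" "bij_betw b {..<4} B" "bij_betw c {..<4} C"
    and "labelled_net (rep \<circ> a) (rep \<circ> b) (rep \<circ> c) l L"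
    by (rule dual_3_net_labelling[OF assms rep]) blast
  then interpret labelled_net "rep \<circ> a" "rep \<circ> b" "rep \<circ> c" l L by simp
  \<comment> \<open>The list has 4 + 3 + 2 = 9 entries, one fewer than the number of cubic
    monomials.\<close>
  define V where "V = map (rep \<circ> a) [0..<4] @ map (rep \<circ> b) [0..<3] @ map (rep \<circ> c) [0..<2]"
  have "card (set V) < 10"
    using card_length[of V] by (simp add: V_def)
  then obtain p :: "'a poly3" where p: "p \<noteq> 0" "homogeneous3 3 p"
    and V: "\<And>v. v \<in> set V \<Longrightarrow> eval_poly3 p v = 0"
    using cubic_through_nine_points[of "set V"] by blast
  note hf = eval_poly3_hform[OF p(2)]
  have a: "eval_poly3 p ((rep \<circ> a) i) = 0" if "i < 4" for i
    by (rule V) (use that in \<open>auto simp: V_def\<close>)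
  have b: "eval_poly3 p ((rep \<circ> b) i) = 0" if "i < 3" for i
    by (rule V) (use that in \<open>auto simp: V_def\<close>)
  have c: "eval_poly3 p ((rep \<circ> c) i) = 0" if "i < 2" for i
    by (rule V) (use that in \<open>auto simp: V_def\<close>)
  have gen: "eval_poly3 p ((rep \<circ> b) 3) = 0 \<and> eval_poly3 p ((rep \<circ> c) 2) = 0 \<and> eval_poly3 p ((rep \<circ> c) 3) = 0"
    by (rule grids_generate[OF hf a b c c]) auto
  have lt4: "i = 0 \<or> i = 1 \<or> i = 2 \<or> i = 3" if "i < 4" for i :: nat
    using that by linarith
  have zero: "eval_poly3 p (rep P) = 0" if "P \<in> A \<union> B \<union> C" for P
  proof -
    from that lab obtain i where "i < 4" "P = a i \<or> P = b i \<or> P = c i"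
      by (auto simp: bij_betw_def)
    then show ?thesis using a[of i] b[of i] c[of i] gen lt4[of i] by auto
  qed
  have pts: "A \<union> B \<union> C \<subseteq> pg2_points" using assms by (auto simp: dual_3_net_def)
  have "vanishes_at p P" if "P \<in> A \<union> B \<union> C" for P
  proof -
    have "P = range (\<lambda>k. k *s rep P)" using rep[of P] that pts vec.span_singleton by blast
    then have "\<forall>v\<in>P. \<exists>k. v = k *s rep P" by blast
    then show ?thesis
      unfolding vanishes_at_def using hform_homogeneous[OF hf] zero[OF that] by fastforce
  qed
  with p show ?thesis by blast
qed

end
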